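(* Let $p\ge1$ be a natural number and let $\mu$ be the probability measure on the unit circle associated with the pair of sequences $\{\{c_n\}_{n=1}^{\infty},\{d_n\}_{n=1}^{\infty}\}$, where $\{c_n\}_{n=1}^\infty$ is real, $\{d_n\}_{n=1}^\infty$ is a positive chain sequence with minimal parameter sequence $\{m_n\}_{n=0}^\infty$, and $\{c_n\}_{n=1}^{\infty}$ and $\{m_n\}_{n=1}^{\infty}$ are periodic sequences of period $p$. In addition, suppose that $c_{2n}=-c_{2n-1}$ for $n\ge1$. Then: (i) if $p$ is even, the measure $\mu$ has a $p$-periodic sequence of Verblunsky coefficients; (ii) if $p$ is odd, the measure $\mu$ is symmetric and has a $p$-periodic sequence of Verblunsky coefficients.
   Context: $\mathbb{T}=\{z\in\mathbb{C}:|z|=1\}$. A sequence $\{a_n\}$ is periodic of period $p$ ($p$-periodic) if $a_{n+p}=a_n$ for all indices $n$ of the sequence. A real sequence $\{d_n\}_{n=1}^\infty$ is a positive chain sequence if there is a sequence $\{g_n\}_{n=0}^\infty$ (a parameter sequence) with $0\le g_0<1$, $0<g_n<1$ for $n\ge1$, and $d_n=(1-g_{n-1})g_n$ for $n\ge1$. The minimal parameter sequence $\{m_n\}_{n=0}^\infty$ is the one with $m_0=0$. For a nontrivial probability measure $\mu$ on $\mathbb{T}$ (infinite support) with monic orthogonal polynomials $\phi_n$, the Verblunsky coefficients are $\alpha_{n-1}=-\overline{\phi_n(0)}$, $n\ge1$; every sequence $\{\alpha_n\}_{n\ge0}$ with $|\alpha_n|<1$ is the Verblunsky sequence of exactly one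 nontrivial probability measure on $\mathbb{T}$. The measure associated with a pair $\{\{c_n\}_{n=1}^\infty,\{d_n\}_{n=1}^\infty\}$, where $\{c_n\}$ is real and $\{d_n\}$ is a positive chain sequence with minimal parameter sequence $\{m_n\}$, is the unique nontrivial probability measure on $\mathbb{T}$ with Verblunsky coefficients $$\alpha_{n-1}=\overline{\tau}_{n-1}\,\frac{1-2m_n-ic_n}{1-ic_n},\quad n\ge1,\qquad \tau_0=1,\quad \tau_n=\prod_{k=1}^n\frac{1-ic_k}{1+ic_k}.$$ The measure $\mu$ is called symmetric if $d\mu(z)=-d\mu(1/z)$ for $z\in\mathbb{T}$, i.e. $\mu$ is invariant under complex conjugation $z\mapsto \bar z=1/z$ (the sign reflects the reversal of orientation of the circle). *)

theory Defs
  imports "HOL-Probability.Probability" "HOL-Computational_Algebra.Polynomial"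
begin

text \<open>Sequences indexed by $n \ge 1$ are functions on \<^typ>\<open>nat\<close> whose value at $0$ is never used;
  accordingly, \<open>k\<close> below is the first index of the sequence.\<close>

definition periodic_from :: "nat \<Rightarrow> nat \<Rightarrow> (nat \<Rightarrow> 'a) \<Rightarrow> bool" where
  "periodic_from k p a \<longleftrightarrow> (\<forall>n\<ge>k. a (n + p) = a n)"

definition parameter_sequence :: "(nat \<Rightarrow> real) \<Rightarrow> (nat \<Rightarrow> real) \<Rightarrow> bool" where
  "parameter_sequence d g \<longleftrightarrow>
     0 \<le> g 0 \<and> g 0 < 1 \<and>
     (\<forall>n\<ge>1. 0 < g n \<and> g n < 1) \<and>
     (\<forall>n\<ge>1. d n = (1 - g (n - 1)) * g n)"

definition positive_chain_sequence :: "(nat \<Rightarrow> real) \<Rightarrow> bool" where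
  "positive_chain_sequence d \<longleftrightarrow> (\<exists>g. parameter_sequence d g)"

definition minimal_parameter_sequence :: "(nat \<Rightarrow> real) \<Rightarrow> (nat \<Rightarrow> real) \<Rightarrow> bool" where
  "minimal_parameter_sequence d m \<longleftrightarrow> parameter_sequence d m \<and> m 0 = 0"

text \<open>The topological support, for a measure living on a Borel subset of a topological space.\<close>

definition measure_support :: "'a::topological_space measure \<Rightarrow> 'a set" where
  "measure_support M =
     {x \<in> space M. \<forall>U. open U \<longrightarrow> x \<in> U \<longrightarrow> emeasure M (U \<inter> space M) > 0}"

definition nontrivial_circle_measure :: "complex measure \<Rightarrow> bool" where
  "nontrivial_circle_measure M \<longleftrightarrow>
     prob_space M \<and> sets M = sets (restrict_space borel (sphere 0 1)) \<and>
     infinite (measure_support M)"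

definition monic_orthogonal_polys :: "complex measure \<Rightarrow> (nat \<Rightarrow> complex poly) \<Rightarrow> bool" where
  "monic_orthogonal_polys M \<phi> \<longleftrightarrow>
     (\<forall>n. degree (\<phi> n) = n \<and> lead_coeff (\<phi> n) = 1) \<and>
     (\<forall>j n. j \<noteq> n \<longrightarrow> (LINT z|M. poly (\<phi> j) z * cnj (poly (\<phi> n) z)) = 0)"

text \<open>The description is well defined for every nontrivial measure on the circle, since there
  the inner product is positive definite on polynomials.\<close>

definition monic_OP :: "complex measure \<Rightarrow> nat \<Rightarrow> complex poly" where
  "monic_OP M = (THE \<phi>. monic_orthogonal_polys M \<phi>)"

definition verblunsky :: "complex measure \<Rightarrow> nat \<Rightarrow> complex" where
  "verblunsky M n = - cnj (poly (monic_OP M (Suc n)) 0)"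

definition tau :: "(nat \<Rightarrow> real) \<Rightarrow> nat \<Rightarrow> complex" where
  "tau c n = (\<Prod>k=1..n. (1 - \<i> * of_real (c k)) / (1 + \<i> * of_real (c k)))"

text \<open>The measure associated with the pair \<open>(c, d)\<close>, as a predicate. By Verblunsky's theorem exactly one
  measure satisfies it when \<open>d\<close> is a positive chain sequence; the sequence \<open>m\<close>
  is then also unique.\<close>

definition associated_measure ::
    "(nat \<Rightarrow> real) \<Rightarrow> (nat \<Rightarrow> real) \<Rightarrow> complex measure \<Rightarrow> bool" where
  "associated_measure c d M \<longleftrightarrow>
     nontrivial_circle_measure M \<and>
     (\<exists>m. minimal_parameter_sequence d m \<and>
        (\<forall>n\<ge>1. verblunsky M (n - 1) =
           cnj (tau c (n - 1)) *
           ((1 - 2 * of_real (m n) - \<i> * of_real (c n)) / (1 - \<i> * of_real (c n)))))"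

text \<open>On the circle $1/z = \bar z$. The sign in $d\mu(z) = -d\mu(1/z)$ only reflects the reversal of
  orientation, so the condition is invariance of the (positive) measure under conjugation.\<close>

definition symmetric_circle_measure :: "complex measure \<Rightarrow> bool" where
  "symmetric_circle_measure M \<longleftrightarrow> distr M M cnj = M"

end

theory Submission imports Defs begin

text \<open>
  For even \<open>p\<close> the claim is a computation. The relation \<open>c\<^sub>2\<^sub>n = - c\<^sub>2\<^sub>n\<^sub>-\<^sub>1\<close> makes the factors of
  \<open>\<tau>\<close> cancel in consecutive pairs, so a period of even length consists of whole pairs, contributes
  the factor \<open>1\<close>, and \<open>\<tau>\<close> inherits the period (\<open>tau_periodic\<close>). The remaining factor of the
  Verblunsky coefficient depends only on \<open>c\<^sub>n\<close> and \<open>m\<^sub>n\<close>.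

  For odd \<open>p\<close> the hypotheses are far more restrictive: shifting by \<open>p\<close> exchanges the two parities,
  so \<open>c\<close> changes sign at every step, and an odd number of sign changes returns to the initial value;
  hence \<open>c = 0\<close> (\<open>odd_period_imp_zero\<close>). Then \<open>\<tau> = 1\<close> and the coefficients are the real numbers
  \<open>1 - 2 m\<^sub>n\<close>, which are periodic. It remains to see that a measure with real Verblunsky coefficients
  is symmetric. By the Szego recurrence (\<open>szego_recurrence\<close>)
  \<open>\<phi>\<^sub>n\<^sub>+\<^sub>1 = z \<phi>\<^sub>n - cnj \<alpha>\<^sub>n \<cdot> \<phi>\<^sub>n\<^sup>*\<close> all orthogonal polynomials have real coefficients, and the
  relations \<open>\<langle>1, \<phi>\<^sub>n\<rangle> = 0\<close> then determine the moments one after the other as real numbers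
  (\<open>moments_real\<close>). Thus the measure and its image under conjugation have the same trigonometric
  moments; by Stone-Weierstrass they integrate continuous functions equally, hence agree on closed
  sets, hence coincide (\<open>symmetric_if_real_moments\<close>).

  The recurrence and the existence of the orthogonal polynomials come out of one construction
  (\<open>szego_step\<close>): the recurrence step, applied to a monic polynomial of degree \<open>n\<close> orthogonal to
  all lower powers, yields such a polynomial of degree \<open>n + 1\<close> for a suitable constant. As the
  orthogonal polynomials are unique, this constant must be the conjugate of the Verblunsky coefficient.
\<close>

section \<open>The inner product of polynomials on the circle\<close>

locale circle_prob_space = prob_space M for M :: "complex measure" +
  assumes sets_M: "sets M = sets (restrict_space borel (sphere 0 1))"
begin

lemma space_M: "space M = sphere 0 1"
  using sets_eq_imp_space_eq[OF sets_M] by (simp add: space_restrict_space)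

lemma cnj_eq_inverse: "z \<in> space M \<Longrightarrow> cnj z = inverse z"
  by (simp add: space_M divide_conv_cnj inverse_eq_divide)

lemma mult_cnj_eq_1: "z \<in> space M \<Longrightarrow> z * cnj z = 1"
  by (simp add: space_M complex_norm_square[symmetric])

lemma measurable_continuous:
  assumes "continuous_on (sphere 0 1) f"
  shows "f \<in> borel_measurable M"
  using borel_measurable_continuous_on_restrict[OF assms] measurable_cong_sets[OF sets_M refl] by blast

lemma integrable_continuous:
  fixes f :: "complex \<Rightarrow> 'b :: euclidean_space"
  assumes "continuous_on (sphere 0 1) f"
  shows "integrable M f"
proof -
  have "compact (f ` sphere 0 1)"
    using assms compact_continuous_image compact_sphere by blast
  then obtain B where B: "\<And>z. z \<in> sphere 0 1 \<Longrightarrow> norm (f z) \<le> B"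
    by (meson compact_imp_bounded bounded_iff imageI)
  show ?thesis
    by (rule integrable_const_bound[where B = B])
      (use B measurable_continuous[OF assms] in \<open>auto simp: space_M\<close>)
qed

definition ip :: "complex poly \<Rightarrow> complex poly \<Rightarrow> complex" where
  "ip P Q = (LINT z|M. poly P z * cnj (poly Q z))"

lemma integrable_poly: "integrable M (\<lambda>z. poly P z * cnj (poly Q z))"
  by (intro integrable_continuous continuous_intros)

lemma ip_diff_left: "ip (P - Q) R = ip P R - ip Q R"
  by (simp add: ip_def left_diff_distrib Bochner_Integration.integral_diff[OF integrable_poly integrable_poly])

lemma ip_smult_left: "ip (smult a P) Q = a * ip P Q"
  by (simp add: ip_def mult.assoc)

lemma ip_commute: "ip Q P = cnj (ip P Q)"
  by (simp only: ip_def flip: Bochner_Integration.integral_cnj) (simp add: mult.commute)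

lemma ip_sum_right: "ip P (\<Sum>i\<in>A. smult (a i) (Q i)) = (\<Sum>i\<in>A. cnj (a i) * ip P (Q i))"
proof -
  have "ip P (\<Sum>i\<in>A. smult (a i) (Q i))
      = (LINT z|M. (\<Sum>i\<in>A. cnj (a i) * (poly P z * cnj (poly (Q i) z))))"
    by (simp add: ip_def poly_sum sum_distrib_left mult.left_commute)
  also have "\<dots> = (\<Sum>i\<in>A. LINT z|M. cnj (a i) * (poly P z * cnj (poly (Q i) z)))"
    by (intro Bochner_Integration.integral_sum integrable_mult_right integrable_poly)
  finally show ?thesis
    by (simp add: ip_def)
qed

lemma ip_expand_right: "ip P Q = (\<Sum>i\<le>degree Q. cnj (coeff Q i) * ip P (monom 1 i))"
proof -
  have "Q = (\<Sum>i\<le>degree Q. smult (coeff Q i) (monom 1 i))"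
    by (simp add: smult_monom poly_as_sum_of_monoms)
  then show ?thesis
    by (metis ip_sum_right)
qed

lemma ip_eq_0I:
  assumes "\<And>k. k \<le> degree Q \<Longrightarrow> ip P (monom 1 k) = 0"
  shows "ip P Q = 0"
  by (subst ip_expand_right) (simp add: assms)

text \<open>Multiplication by \<open>z\<close> is an isometry because \<open>\<bar>z\<bar> = 1\<close> on the circle.\<close>

lemma ip_shift: "ip (pCons 0 P) (pCons 0 Q) = ip P Q"
  unfolding ip_def
proof (rule Bochner_Integration.integral_cong[OF refl])
  fix z assume z: "z \<in> space M"
  have "poly (pCons 0 P) z * cnj (poly (pCons 0 Q) z) = (z * cnj z) * (poly P z * cnj (poly Q z))"
    by simp
  then show "poly (pCons 0 P) z * cnj (poly (pCons 0 Q) z) = poly P z * cnj (poly Q z)"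
    by (simp only: mult_cnj_eq_1[OF z] mult_1)
qed

lemma ip_monom_shift: "ip (monom 1 (j + k)) (monom 1 (i + k)) = ip (monom 1 j) (monom 1 i)"
  by (induction k) (simp_all add: monom_Suc ip_shift)

text \<open>The reversed polynomial \<open>\<phi>\<^sup>*(z) = z\<^sup>n \<cdot> cnj (\<phi> (1 / cnj z))\<close> for \<open>n = degree \<phi>\<close>.\<close>

definition reversed :: "complex poly \<Rightarrow> complex poly" where
  "reversed P = map_poly cnj (reflect_poly P)"

lemma poly_reversed:
  assumes "z \<in> space M"
  shows "poly (reversed P) z = z ^ degree P * cnj (poly P z)"
proof -
  have "z \<noteq> 0" using assms by (auto simp: space_M)
  then show ?thesis
    using cnj_eq_inverse[OF assms] by (simp add: reversed_def poly_reflect_poly_nz)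
qed

lemma degree_reversed_le: "degree (reversed P) \<le> degree P"
  using map_poly_degree_leq[of cnj "reflect_poly P"] degree_reflect_poly_le[of P]
  by (simp add: reversed_def)

lemma coeff_0_reversed: "coeff (reversed P) 0 = cnj (lead_coeff P)"
  by (simp add: reversed_def coeff_map_poly)

text \<open>On the circle, \<open>\<phi>\<^sup>* \<cdot> cnj (z\<^sup>k) = cnj (\<phi> \<cdot> cnj (z\<^sup>(n-k)))\<close>: reversal turns the orthogonality of
  \<open>\<phi>\<close> to \<open>1, \<dots>, z\<^sup>(n-1)\<close> into orthogonality of \<open>\<phi>\<^sup>*\<close> to \<open>z, \<dots>, z\<^sup>n\<close>.\<close>

lemma ip_reversed_monom:
  assumes "k \<le> degree P"
  shows "ip (reversed P) (monom 1 k) = cnj (ip P (monom 1 (degree P - k)))"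
proof -
  have "ip (reversed P) (monom 1 k) = (LINT z|M. cnj (poly P z * cnj (poly (monom 1 (degree P - k)) z)))"
    unfolding ip_def
  proof (rule Bochner_Integration.integral_cong[OF refl])
    fix z assume z: "z \<in> space M"
    have "z ^ degree P * cnj z ^ k = z ^ (degree P - k) * (z * cnj z) ^ k"
      using assms by (simp add: power_mult_distrib flip: power_add mult.assoc)
    then show "poly (reversed P) z * cnj (poly (monom 1 k) z)
        = cnj (poly P z * cnj (poly (monom 1 (degree P - k)) z))"
      using mult_cnj_eq_1[OF z] by (simp add: poly_reversed[OF z] poly_monom mult_ac)
  qed
  then show ?thesis
    by (simp only: ip_def Bochner_Integration.integral_cnj)
qed

end

section \<open>Orthogonal polynomials and the Szego recurrence\<close>

locale nontrivial_circle = circle_prob_space +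
  assumes infinite_support: "infinite (measure_support M)"
begin

text \<open>A polynomial of norm zero vanishes almost everywhere, hence, being continuous, on the whole
  support; an infinite set of roots forces it to be zero.\<close>

lemma ip_self_eq_0:
  assumes "ip P P = 0"
  shows "P = 0"
proof (rule ccontr)
  assume "P \<noteq> 0"
  have eq: "poly P z * cnj (poly P z) = of_real ((cmod (poly P z))\<^sup>2)" for z
    by (simp only: complex_norm_square)
  have int: "integrable M (\<lambda>z. (cmod (poly P z))\<^sup>2)"
    by (intro integrable_continuous continuous_intros)
  have "complex_of_real (LINT z|M. (cmod (poly P z))\<^sup>2) = 0"
    using assms unfolding ip_def eq by (simp only: integral_complex_of_real)
  then have ae: "AE z in M. (cmod (poly P z))\<^sup>2 = 0"
    using integral_nonneg_eq_0_iff_AE[OF int] by simp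
  have "measure_support M \<subseteq> {z. poly P z = 0}"
  proof
    fix z assume z: "z \<in> measure_support M"
    show "z \<in> {z. poly P z = 0}"
    proof (rule ccontr)
      let ?U = "{w. poly P w \<noteq> 0}"
      assume "z \<notin> {z. poly P z = 0}"
      moreover have U: "open ?U"
        by (intro open_Collect_neq continuous_intros)
      ultimately have "emeasure M (?U \<inter> space M) > 0"
        using z by (auto simp: measure_support_def)
      moreover have "?U \<inter> space M \<in> sets M"
        using U by (auto simp: sets_M sets_restrict_space space_M)
      moreover have "AE w in M. poly P w = 0"
        using ae by simp
      ultimately show False
        using AE_iff_measurable[of "?U \<inter> space M" M "\<lambda>w. poly P w = 0"]
        by (auto simp: Int_def conj_commute)
    qed
  qed
  then show False
    using infinite_support poly_roots_finite[OF \<open>P \<noteq> 0\<close>] finite_subset by blast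
qed

definition monic_ortho :: "nat \<Rightarrow> complex poly \<Rightarrow> bool" where
  "monic_ortho n P \<longleftrightarrow> degree P = n \<and> lead_coeff P = 1 \<and> (\<forall>k<n. ip P (monom 1 k) = 0)"

lemma monic_ortho_lower_degree:
  assumes "monic_ortho n P" "degree Q < n"
  shows "ip P Q = 0"
  using assms by (auto simp: monic_ortho_def intro: ip_eq_0I[of Q P])

lemma monic_ortho_unique:
  assumes P: "monic_ortho n P" and Q: "monic_ortho n Q"
  shows "P = Q"
proof (cases "n = 0")
  case True
  then show ?thesis
    using P Q by (auto simp: monic_ortho_def elim!: degree_eq_zeroE)
next
  case False
  have "degree (P - Q) < n"
  proof (rule degree_lessI)
    show "P - Q \<noteq> 0 \<or> n > 0" using False by simp
    show "\<forall>k\<ge>n. coeff (P - Q) k = 0"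
      using P Q by (auto simp: monic_ortho_def le_less coeff_eq_0)
  qed
  then have "ip (P - Q) (P - Q) = 0"
    using monic_ortho_lower_degree[OF P] monic_ortho_lower_degree[OF Q] by (simp add: ip_diff_left)
  then show ?thesis
    using ip_self_eq_0 by fastforce
qed

text \<open>Both \<open>z \<phi>\<close> and \<open>\<phi>\<^sup>*\<close> are orthogonal to \<open>z, \<dots>, z\<^sup>n\<close>, so a combination only has to be made
  orthogonal to \<open>1\<close>. This is possible since \<open>\<langle>\<phi>\<^sup>*, 1\<rangle>\<close> is the conjugate of \<open>\<langle>\<phi>, z\<^sup>n\<rangle>\<close>, whose
  vanishing would make \<open>\<phi>\<close> orthogonal to itself.\<close>

lemma szego_step:
  assumes \<phi>: "monic_ortho n \<phi>"
  obtains a where "monic_ortho (Suc n) (pCons 0 \<phi> - smult a (reversed \<phi>))"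
proof -
  have deg: "degree \<phi> = n" and lead: "coeff \<phi> n = 1"
    and orth: "\<And>k. k < n \<Longrightarrow> ip \<phi> (monom 1 k) = 0"
    using \<phi> by (auto simp: monic_ortho_def)
  have "\<phi> \<noteq> 0" using lead by auto
  have "ip \<phi> (monom 1 n) \<noteq> 0"
  proof
    assume "ip \<phi> (monom 1 n) = 0"
    then have "ip \<phi> (monom 1 k) = 0" if "k \<le> n" for k
      using orth that by (cases "k = n") simp_all
    then have "ip \<phi> \<phi> = 0"
      by (rule ip_eq_0I) (simp only: deg)
    then show False
      using ip_self_eq_0 \<open>\<phi> \<noteq> 0\<close> by blast
  qed
  then have nz: "ip (reversed \<phi>) (monom 1 0) \<noteq> 0"
    using ip_reversed_monom[of 0 \<phi>] deg by simp
  define a where "a = ip (pCons 0 \<phi>) (monom 1 0) / ip (reversed \<phi>) (monom 1 0)"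
  let ?\<psi> = "pCons 0 \<phi> - smult a (reversed \<phi>)"
  have small: "degree (smult a (reversed \<phi>)) < Suc n"
    using degree_reversed_le[of \<phi>] degree_smult_le[of a "reversed \<phi>"] deg by linarith
  have deg1: "degree (pCons 0 \<phi>) = Suc n"
    using \<open>\<phi> \<noteq> 0\<close> deg by simp
  have coeff: "coeff ?\<psi> (Suc n) = 1"
    using coeff_eq_0[OF small] lead by simp
  have "degree ?\<psi> = Suc n"
    using small deg1 coeff by (intro antisym degree_diff_le le_degree) auto
  moreover have "ip ?\<psi> (monom 1 k) = 0" if "k < Suc n" for k
  proof (cases k)
    case 0
    then show ?thesis
      using nz by (simp add: ip_diff_left ip_smult_left a_def del: monom_0)
  next
    case (Suc j)
    then have "ip (pCons 0 \<phi>) (monom 1 k) = 0" "ip (reversed \<phi>) (monom 1 k) = 0"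
      using that deg by (simp_all add: ip_reversed_monom orth) (simp add: monom_Suc ip_shift orth)
    then show ?thesis
      by (simp add: ip_diff_left ip_smult_left)
  qed
  ultimately have "monic_ortho (Suc n) ?\<psi>"
    using coeff by (simp add: monic_ortho_def)
  then show ?thesis ..
qed

lemma monic_ortho_exists: "\<exists>P. monic_ortho n P"
proof (induction n)
  case 0
  have "monic_ortho 0 1" by (simp add: monic_ortho_def)
  then show ?case ..
next
  case (Suc n)
  then show ?case by (metis szego_step)
qed

text \<open>Mutual orthogonality of the whole family splits into one condition per degree, to which
  existence and uniqueness in each degree apply.\<close>

lemma monic_orthogonal_polys_iff: "monic_orthogonal_polys M \<phi> \<longleftrightarrow> (\<forall>n. monic_ortho n (\<phi> n))"
proof
  assume \<phi>: "monic_orthogonal_polys M \<phi>"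
  have deg: "degree (\<phi> n) = n" and lead: "coeff (\<phi> n) n = 1" for n
    using \<phi> by (metis monic_orthogonal_polys_def)+
  have orth: "ip (\<phi> n) (\<phi> j) = 0" if "j < n" for j n
    using \<phi> that by (auto simp: monic_orthogonal_polys_def ip_def)
  \<comment> \<open>\<open>z\<^sup>k\<close> differs from \<open>\<phi>\<^sub>k\<close> by a combination of lower powers.\<close>
  have "ip (\<phi> n) (monom 1 k) = 0" if "k < n" for k n
    using that
  proof (induction k rule: less_induct)
    case (less k)
    have "0 = (\<Sum>i\<le>k. cnj (coeff (\<phi> k) i) * ip (\<phi> n) (monom 1 i))"
      using orth[OF \<open>k < n\<close>] ip_expand_right[of "\<phi> n" "\<phi> k"] by (simp add: deg)
    also have "\<dots> = (\<Sum>i<k. cnj (coeff (\<phi> k) i) * ip (\<phi> n) (monom 1 i)) + ip (\<phi> n) (monom 1 k)"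
      by (simp add: lead flip: lessThan_Suc_atMost)
    also have "(\<Sum>i<k. cnj (coeff (\<phi> k) i) * ip (\<phi> n) (monom 1 i)) = 0"
      using less by (intro sum.neutral) auto
    finally show ?case by simp
  qed
  then show "\<forall>n. monic_ortho n (\<phi> n)"
    by (simp add: monic_ortho_def deg lead)
next
  assume \<phi>: "\<forall>n. monic_ortho n (\<phi> n)"
  have "ip (\<phi> j) (\<phi> n) = 0" if "j \<noteq> n" for j n
  proof (cases "n < j")
    case True
    then have "degree (\<phi> n) < j"
      using \<phi> by (simp add: monic_ortho_def)
    with \<phi> show ?thesis
      using monic_ortho_lower_degree by blast
  next
    case False
    then have "degree (\<phi> j) < n"
      using \<phi> that by (simp add: monic_ortho_def)
    with \<phi> have "ip (\<phi> n) (\<phi> j) = 0"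
      using monic_ortho_lower_degree by blast
    then show ?thesis by (metis ip_commute complex_cnj_zero)
  qed
  then show "monic_orthogonal_polys M \<phi>"
    using \<phi> unfolding monic_orthogonal_polys_def monic_ortho_def ip_def by metis
qed

lemma monic_ortho_monic_OP: "monic_ortho n (monic_OP M n)"
proof -
  obtain \<phi> where \<phi>: "\<forall>n. monic_ortho n (\<phi> n)"
    using monic_ortho_exists by metis
  have "monic_OP M = \<phi>"
    unfolding monic_OP_def monic_orthogonal_polys_iff
    by (rule the_equality) (use \<phi> monic_ortho_unique in blast)+
  then show ?thesis using \<phi> by simp
qed

text \<open>The factor of \<open>\<phi>\<^sub>n\<^sup>*\<close> is read off at \<open>z = 0\<close>, where \<open>\<phi>\<^sub>n\<^sup>*\<close> takes the value \<open>1\<close>.\<close>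

lemma szego_recurrence:
  "monic_OP M (Suc n) =
     pCons 0 (monic_OP M n) - smult (cnj (verblunsky M n)) (reversed (monic_OP M n))"
proof -
  have \<phi>: "monic_ortho n (monic_OP M n)" by (rule monic_ortho_monic_OP)
  then obtain a where "monic_ortho (Suc n) (pCons 0 (monic_OP M n) - smult a (reversed (monic_OP M n)))"
    by (rule szego_step)
  then have eq: "monic_OP M (Suc n) = pCons 0 (monic_OP M n) - smult a (reversed (monic_OP M n))"
    using monic_ortho_monic_OP monic_ortho_unique by blast
  have "poly (reversed (monic_OP M n)) 0 = 1"
    using \<phi> unfolding monic_ortho_def poly_0_coeff_0 coeff_0_reversed by (metis complex_cnj_one)
  then have "cnj (verblunsky M n) = a"
    by (simp add: verblunsky_def eq)
  then show ?thesis using eq by simp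
qed

section \<open>Real Verblunsky coefficients give real moments\<close>

lemma monic_OP_real_coeffs:
  assumes "\<And>n. verblunsky M n \<in> \<real>"
  shows "coeff (monic_OP M n) i \<in> \<real>"
proof (induction n arbitrary: i)
  case 0
  have "degree (monic_OP M 0) = 0" "coeff (monic_OP M 0) 0 = 1"
    using monic_ortho_monic_OP[of 0] by (auto simp: monic_ortho_def)
  then show ?case by (cases i) (auto simp: coeff_eq_0)
next
  case (Suc n)
  have "coeff (reversed (monic_OP M n)) i \<in> \<real>"
    using Suc by (simp add: reversed_def coeff_map_poly coeff_reflect_poly Reals_cnj_iff)
  then show ?case
    using Suc assms by (auto simp: szego_recurrence coeff_pCons Reals_cnj_iff intro!: Reals_diff Reals_mult split: nat.splits)
qed

text \<open>Orthogonality of \<open>\<phi>\<^sub>k\<close> to \<open>1\<close> expresses the \<open>k\<close>-th moment through lower ones with the real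
  coefficients of \<open>\<phi>\<^sub>k\<close>.\<close>

lemma moments_real:
  assumes "\<And>n. verblunsky M n \<in> \<real>"
  shows "ip 1 (monom 1 k) \<in> \<real>"
proof (induction k rule: less_induct)
  case (less k)
  show ?case
  proof (cases "k = 0")
    case True
    then show ?thesis by (simp add: ip_def prob_space)
  next
    case False
    let ?\<phi> = "monic_OP M k"
    have \<phi>: "degree ?\<phi> = k" "coeff ?\<phi> k = 1"
      using monic_ortho_monic_OP[of k] by (auto simp: monic_ortho_def)
    have "ip ?\<phi> 1 = 0"
      using monic_ortho_lower_degree[OF monic_ortho_monic_OP, of 1 k] False by simp
    then have "0 = ip 1 ?\<phi>"
      by (metis ip_commute complex_cnj_zero)
    also have "\<dots> = (\<Sum>i\<le>k. cnj (coeff ?\<phi> i) * ip 1 (monom 1 i))"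
      using ip_expand_right[of 1 ?\<phi>] by (simp add: \<phi>)
    also have "\<dots> = (\<Sum>i<k. cnj (coeff ?\<phi> i) * ip 1 (monom 1 i)) + ip 1 (monom 1 k)"
      by (simp add: \<phi> flip: lessThan_Suc_atMost)
    finally have "ip 1 (monom 1 k) = - (\<Sum>i<k. cnj (coeff ?\<phi> i) * ip 1 (monom 1 i))"
      by (simp add: eq_neg_iff_add_eq_0 add.commute)
    moreover have "(\<Sum>i<k. cnj (coeff ?\<phi> i) * ip 1 (monom 1 i)) \<in> \<real>"
      using less monic_OP_real_coeffs[OF assms] by (intro sum_in_Reals Reals_mult) (auto simp: Reals_cnj_iff)
    ultimately show ?thesis by simp
  qed
qed

end

section \<open>Real moments give a symmetric measure\<close>

context circle_prob_space
begin

lemma ip_monom_commute: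
  assumes "\<And>k. ip 1 (monom 1 k) \<in> \<real>"
  shows "ip (monom 1 i) (monom 1 j) = ip (monom 1 j) (monom 1 i)"
proof -
  have *: "ip (monom 1 i) (monom 1 j) = ip (monom 1 j) (monom 1 i)" if "i \<le> j" for i j
  proof -
    have "ip (monom 1 i) (monom 1 j) = ip 1 (monom 1 (j - i))"
      using ip_monom_shift[of 0 i "j - i"] that by (simp add: monom_0 one_pCons)
    then show ?thesis
      using assms[of "j - i"] ip_commute[of "monom 1 j" "monom 1 i"] by (simp add: Reals_cnj_iff)
  qed
  show ?thesis
    using *[of i j] *[of j i] by (cases "i \<le> j") auto
qed

text \<open>Every real polynomial in the real and imaginary part of \<open>z\<close> is a Laurent polynomial on the
  circle; clearing the negative powers gives a polynomial times a power of \<open>cnj z\<close>, and this form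
  is stable under sums and products.\<close>

lemma real_polynomial_function_Laurent:
  assumes "real_polynomial_function g"
  shows "\<exists>P n. \<forall>z\<in>sphere 0 1. complex_of_real (g z) = poly P z * cnj z ^ n"
  using assms
proof induction
  case (linear f)
  interpret bounded_linear f by fact
  \<comment> \<open>Writing \<open>Re z\<close> and \<open>Im z\<close> through \<open>z\<close> and \<open>cnj z\<close>, the term in \<open>z = z\<^sup>2 \<cdot> cnj z\<close> becomes
    quadratic after the factor \<open>cnj z\<close> is split off.\<close>
  have "complex_of_real (f z) = poly [:(f 1 + \<i> * f \<i>) / 2, 0, (f 1 - \<i> * f \<i>) / 2:] z * cnj z ^ 1"
    if "z \<in> sphere 0 1" for z
  proof -
    have z: "z * cnj z = 1" using that space_M mult_cnj_eq_1 by blast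
    have "f z = f (Re z *\<^sub>R 1 + Im z *\<^sub>R \<i>)"
      by (rule arg_cong[where f = f]) (simp add: complex_eq_iff)
    also have "\<dots> = Re z * f 1 + Im z * f \<i>"
      by (simp only: add scaleR real_scaleR_def)
    finally have "complex_of_real (f z) = (z + cnj z) / 2 * f 1 - \<i> * ((z - cnj z) / 2) * f \<i>"
      by (simp add: complex_eq_iff)
    also have "\<dots> = (f 1 + \<i> * f \<i>) / 2 * cnj z + (f 1 - \<i> * f \<i>) / 2 * z * 1"
      by (simp add: field_simps)
    also have "\<dots> = (f 1 + \<i> * f \<i>) / 2 * cnj z + (f 1 - \<i> * f \<i>) / 2 * z * (z * cnj z)"
      by (simp only: z)
    finally show ?thesis by (simp add: algebra_simps)
  qed
  then show ?case by blast
next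
  case (const c)
  have "complex_of_real c = poly [:complex_of_real c:] z * cnj z ^ 0" for z by simp
  then show ?case by blast
next
  case (add f g)
  then obtain P m Q n where f: "\<forall>z\<in>sphere 0 1. complex_of_real (f z) = poly P z * cnj z ^ m"
    and g: "\<forall>z\<in>sphere 0 1. complex_of_real (g z) = poly Q z * cnj z ^ n"
    by blast
  have "complex_of_real (f z + g z) = poly (P * monom 1 n + Q * monom 1 m) z * cnj z ^ (m + n)"
    if "z \<in> sphere 0 1" for z
  proof -
    have z: "(z * cnj z) ^ k = 1" for k using that space_M mult_cnj_eq_1 by simp
    have "complex_of_real (f z + g z)
        = poly P z * cnj z ^ m * (z * cnj z) ^ n + poly Q z * cnj z ^ n * (z * cnj z) ^ m"
      using f g that by (simp only: z of_real_add mult_1_right)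
    then show ?thesis by (simp add: poly_monom power_add power_mult_distrib algebra_simps)
  qed
  then show ?case by blast
next
  case (mult f g)
  then obtain P m Q n where f: "\<forall>z\<in>sphere 0 1. complex_of_real (f z) = poly P z * cnj z ^ m"
    and g: "\<forall>z\<in>sphere 0 1. complex_of_real (g z) = poly Q z * cnj z ^ n"
    by blast
  have "complex_of_real (f z * g z) = poly (P * Q) z * cnj z ^ (m + n)"
    if "z \<in> sphere 0 1" for z
    using f g that by (simp add: power_add mult_ac)
  then show ?case by blast
qed

lemma integral_cnj_polynomial:
  assumes moments: "\<And>k. ip 1 (monom 1 k) \<in> \<real>" and g: "real_polynomial_function g"
  shows "(LINT z|M. g (cnj z)) = (LINT z|M. g z)"
proof -
  obtain P n where P: "\<And>z. z \<in> space M \<Longrightarrow> complex_of_real (g z) = poly P z * cnj z ^ n"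
    using real_polynomial_function_Laurent[OF g] space_M by metis
  have "complex_of_real (LINT z|M. g (cnj z)) = (LINT z|M. complex_of_real (g (cnj z)))"
    by simp
  also have "\<dots> = (LINT z|M. (\<Sum>i\<le>degree P. coeff P i * (poly (monom 1 n) z * cnj (poly (monom 1 i) z))))"
    by (intro Bochner_Integration.integral_cong refl)
      (subst P, auto simp: space_M poly_altdef[of P] poly_monom sum_distrib_left mult_ac)
  also have "\<dots> = (\<Sum>i\<le>degree P. coeff P i * ip (monom 1 n) (monom 1 i))"
    by (simp add: ip_def Bochner_Integration.integral_sum integrable_poly)
  also have "\<dots> = (\<Sum>i\<le>degree P. coeff P i * ip (monom 1 i) (monom 1 n))"
    by (simp add: ip_monom_commute[OF moments, of n])
  also have "\<dots> = (LINT z|M. (\<Sum>i\<le>degree P. coeff P i * (poly (monom 1 i) z * cnj (poly (monom 1 n) z))))"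
    by (simp add: ip_def Bochner_Integration.integral_sum integrable_poly)
  also have "\<dots> = (LINT z|M. complex_of_real (g z))"
    by (intro Bochner_Integration.integral_cong refl)
      (auto simp: P poly_altdef[of P] poly_monom sum_distrib_left mult_ac)
  finally show ?thesis by simp
qed

lemma continuous_on_sphere_cnj:
  assumes "continuous_on (sphere 0 1) f"
  shows "continuous_on (sphere 0 1) (\<lambda>z. f (cnj z))"
  by (rule continuous_on_compose2[OF assms]) (auto intro!: continuous_intros)

lemma integral_cnj_continuous:
  fixes f :: "complex \<Rightarrow> real"
  assumes moments: "\<And>k. ip 1 (monom 1 k) \<in> \<real>" and f: "continuous_on (sphere 0 1) f"
  shows "(LINT z|M. f (cnj z)) = (LINT z|M. f z)"
proof (rule ccontr)
  \<comment> \<open>Approximating \<open>f\<close> within a third of the supposed difference changes each integral by at most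
    a third, and for the polynomial approximation the two integrals agree.\<close>
  let ?d = "\<bar>(LINT z|M. f (cnj z)) - (LINT z|M. f z)\<bar>"
  assume "(LINT z|M. f (cnj z)) \<noteq> (LINT z|M. f z)"
  then have "?d / 3 > 0" by simp
  then obtain g where g: "real_polynomial_function g"
    and close: "\<And>z. z \<in> sphere 0 1 \<Longrightarrow> \<bar>f z - g z\<bar> < ?d / 3"
    using Stone_Weierstrass_real_polynomial_function[OF compact_sphere f] by blast
  have gc: "continuous_on (sphere 0 1) g"
    using g continuous_on_polymonial_function real_polynomial_function_eq by blast
  have ie: "\<bar>(LINT z|M. u z) - (LINT z|M. v z)\<bar> \<le> ?d / 3"
    if "continuous_on (sphere 0 1) u" "continuous_on (sphere 0 1) v"
      and "\<And>z. z \<in> sphere 0 1 \<Longrightarrow> \<bar>u z - v z\<bar> < ?d / 3" for u v :: "complex \<Rightarrow> real"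
  proof -
    have uv: "integrable M (\<lambda>z. u z - v z)"
      using that by (intro integrable_continuous continuous_intros)
    have "\<bar>LINT z|M. u z - v z\<bar> \<le> (LINT z|M. \<bar>u z - v z\<bar>)"
      using integral_norm_bound[of M "\<lambda>z. u z - v z"] by simp
    also have "\<dots> \<le> (LINT z|M. ?d / 3)"
      using uv that(3) by (intro integral_mono) (auto simp: space_M intro: less_imp_le)
    finally have "\<bar>LINT z|M. u z - v z\<bar> \<le> ?d / 3"
      by (simp add: prob_space)
    then show ?thesis
      using that by (simp add: integrable_continuous)
  qed
  have "\<bar>(LINT z|M. f z) - (LINT z|M. g z)\<bar> \<le> ?d / 3"
    using f gc close by (rule ie)
  moreover have "\<bar>(LINT z|M. f (cnj z)) - (LINT z|M. g (cnj z))\<bar> \<le> ?d / 3"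
    using f gc close by (intro ie continuous_on_sphere_cnj) auto
  moreover have "?d \<le> \<bar>(LINT z|M. f (cnj z)) - (LINT z|M. g (cnj z))\<bar> + \<bar>(LINT z|M. f z) - (LINT z|M. g z)\<bar>"
    unfolding integral_cnj_polynomial[OF moments g] by linarith
  ultimately have "?d \<le> ?d / 3 + ?d / 3"
    by (meson add_mono order_trans)
  then show False
    using \<open>?d / 3 > 0\<close> by argo
qed

lemma measurable_cnj_M: "cnj \<in> measurable M M"
proof -
  have "cnj \<in> measurable M (restrict_space borel (sphere 0 1))"
    by (rule measurable_restrict_space2)
      (auto simp: space_M intro!: measurable_continuous continuous_intros)
  then show ?thesis
    using measurable_cong_sets[OF refl sets_M] by blast
qed

text \<open>The continuous functions \<open>max 0 (1 - k \<cdot> dist(z, C))\<close> decrease to the indicator of the closed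
  set \<open>C\<close>, so dominated convergence transfers the invariance of integrals to \<open>C\<close>.\<close>

lemma measure_cnj_closed:
  assumes moments: "\<And>k. ip 1 (monom 1 k) \<in> \<real>" and C: "closed C"
  shows "measure (distr M M cnj) (C \<inter> space M) = measure M (C \<inter> space M)"
proof (cases "C = {}")
  case False
  define h where "h k z = max 0 (1 - real k * infdist z C)" for k z
  have hc: "continuous_on A (h k)" for A k
    unfolding h_def by (intro continuous_intros)
  have lim: "(\<lambda>k. h k z) \<longlonglongrightarrow> indicator C z" for z
  proof (cases "z \<in> C")
    case True
    then show ?thesis by (simp add: h_def)
  next
    case out: False
    then have pos: "infdist z C > 0"
      using C False infdist_pos_not_in_closed by blast
    obtain N where N: "1 < real N * infdist z C"
      using reals_Archimedean3[OF pos] by blast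
    have "h k z = 0" if "k \<ge> N" for k
    proof -
      have "real N * infdist z C \<le> real k * infdist z C"
        using that pos by (intro mult_right_mono) auto
      then have "1 - real k * infdist z C \<le> 0" using N by linarith
      then show ?thesis by (simp add: h_def)
    qed
    then have "\<forall>\<^sub>F k in sequentially. h k z = 0"
      using eventually_sequentially by blast
    then show ?thesis
      using out by (simp add: tendsto_eventually)
  qed
  have bound: "norm (h k z) \<le> 1" for k z
    by (simp add: h_def infdist_nonneg)
  have C': "C \<inter> space M \<in> sets M"
    using C by (auto simp: sets_M sets_restrict_space space_M)
  have ind: "(indicator A :: complex \<Rightarrow> real) \<in> borel_measurable M"
    if "A \<inter> space M \<in> sets M" for A
    using that borel_measurable_indicator_iff by blast
  have M1: "(\<lambda>k. LINT z|M. h k z) \<longlonglongrightarrow> (LINT z|M. indicat_real C z)"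
    by (rule integral_dominated_convergence[where w = "\<lambda>_. 1"])
      (use C' lim bound ind hc in \<open>auto intro!: measurable_continuous\<close>)
  have "cnj -` (C \<inter> space M) \<inter> space M = cnj -` C \<inter> space M"
    by (auto simp: space_M)
  with measurable_sets[OF measurable_cnj_M C'] have C'': "cnj -` C \<inter> space M \<in> sets M" by simp
  have "(\<lambda>k. LINT z|M. h k (cnj z)) \<longlonglongrightarrow> (LINT z|M. indicat_real C (cnj z))"
  proof (rule integral_dominated_convergence[where w = "\<lambda>_. 1"])
    show "(\<lambda>z. indicat_real C (cnj z)) \<in> borel_measurable M"
      using ind[OF C''] by (simp add: indicator_def[abs_def])
    show "(\<lambda>z. h k (cnj z)) \<in> borel_measurable M" for k
      by (intro measurable_continuous continuous_on_sphere_cnj hc)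
  qed (use lim bound in auto)
  then have "(\<lambda>k. LINT z|M. h k z) \<longlonglongrightarrow> (LINT z|M. indicat_real C (cnj z))"
    by (simp add: integral_cnj_continuous[OF moments hc])
  then have "(LINT z|M. indicat_real C (cnj z)) = (LINT z|M. indicat_real C z)"
    by (rule LIMSEQ_unique[OF _ M1])
  moreover have "(LINT z|M. indicat_real C (cnj z)) = measure M (cnj -` (C \<inter> space M) \<inter> space M)"
  proof -
    have "(LINT z|M. indicat_real C (cnj z)) = (LINT z|M. indicat_real (cnj -` C) z)"
      by (simp add: indicator_def)
    then show ?thesis
      by (auto simp: space_M intro!: arg_cong[where f = "measure M"])
  qed
  moreover have "measure (distr M M cnj) (C \<inter> space M) = measure M (cnj -` (C \<inter> space M) \<inter> space M)"
    using C' measurable_cnj_M by (simp add: measure_distr)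
  ultimately show ?thesis by simp
qed simp

lemma symmetric_if_real_moments:
  assumes moments: "\<And>k. ip 1 (monom 1 k) \<in> \<real>"
  shows "symmetric_circle_measure M"
proof -
  let ?E = "{C. closed C \<and> C \<subseteq> space M}"
  interpret D: prob_space "distr M M cnj"
    by (rule prob_space_distr) (rule measurable_cnj_M)
  have "sets M = (\<inter>) (sphere 0 1) ` sigma_sets UNIV (Collect closed)"
    by (simp add: sets_M sets_restrict_space borel_eq_closed)
  also have "\<dots> = sigma_sets (sphere 0 1) ((\<inter>) (sphere 0 1) ` Collect closed)"
    by (rule sigma_sets_Int) (auto intro: sigma_sets.Basic)
  also have "(\<inter>) (sphere 0 1) ` Collect closed = ?E"
    by (auto simp: space_M image_iff)
  finally have sets: "sets M = sigma_sets (space M) ?E"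
    by (simp only: space_M)
  have "distr M M cnj = M"
  proof (rule measure_eqI_generator_eq)
    show "Int_stable ?E" by (auto simp: Int_stable_def)
    show "emeasure (distr M M cnj) X = emeasure M X" if "X \<in> ?E" for X
      using measure_cnj_closed[OF moments, of X] that
      by (simp add: emeasure_eq_measure D.emeasure_eq_measure Int_absorb2)
    show "range (\<lambda>_::nat. space M) \<subseteq> ?E" by (auto simp: space_M)
  qed (use sets in auto)
  then show ?thesis by (simp add: symmetric_circle_measure_def)
qed

end

section \<open>Periodicity of the coefficients\<close>

lemma minimal_parameter_sequence_unique:
  assumes "minimal_parameter_sequence d m" "minimal_parameter_sequence d m'"
  shows "m n = m' n"
proof (induction n)
  case 0
  then show ?case using assms by (simp add: minimal_parameter_sequence_def)
next
  case (Suc n)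
  have "m n < 1"
    using assms(1) by (cases "n = 0") (auto simp: minimal_parameter_sequence_def parameter_sequence_def)
  moreover have "d (Suc n) = (1 - m n) * m (Suc n)" "d (Suc n) = (1 - m' n) * m' (Suc n)"
    using assms unfolding minimal_parameter_sequence_def parameter_sequence_def
    by (metis diff_Suc_1 le_add1 plus_1_eq_Suc)+
  ultimately show ?case using Suc.IH by simp
qed

text \<open>The factors of \<open>\<tau>\<close> at \<open>2n - 1\<close> and \<open>2n\<close> are reciprocal.\<close>

lemma tau_even:
  assumes "\<forall>n\<ge>1. c (2 * n) = - c (2 * n - 1)"
  shows "tau c (2 * n) = 1"
proof (induction n)
  case (Suc n)
  have ne: "1 + \<i> * complex_of_real x \<noteq> 0" "1 - \<i> * complex_of_real x \<noteq> 0" for x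
    by (auto simp: complex_eq_iff)
  have "c (Suc (Suc (2 * n))) = - c (Suc (2 * n))"
    using assms[rule_format, of "Suc n"] by simp
  then show ?case
    using Suc ne by (simp add: tau_def)
qed (simp add: tau_def)

lemma tau_periodic:
  assumes anti: "\<forall>n\<ge>1. c (2 * n) = - c (2 * n - 1)" and per: "periodic_from 1 p c" and "even p"
  shows "tau c (n + p) = tau c n"
proof (induction n)
  case 0
  have "tau c p = 1"
    using tau_even[OF anti, of "p div 2"] \<open>even p\<close> by simp
  then show ?case by (simp add: tau_def)
next
  case (Suc n)
  have "c (Suc (n + p)) = c (Suc n)"
    using per[unfolded periodic_from_def, rule_format, of "Suc n"] by simp
  then show ?case using Suc by (simp add: tau_def)
qed

text \<open>An odd shift by the period moves the relation \<open>c\<^sub>2\<^sub>n = - c\<^sub>2\<^sub>n\<^sub>-\<^sub>1\<close> to the remaining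
  pairs of neighbours, so the sign of \<open>c\<close> alternates throughout. After a full period this gives
  \<open>c\<^sub>1 = - c\<^sub>1\<close>.\<close>

lemma odd_period_imp_zero:
  fixes c :: "nat \<Rightarrow> real"
  assumes anti: "\<forall>n\<ge>1. c (2 * n) = - c (2 * n - 1)" and per: "periodic_from 1 p c" and "odd p"
    and "n \<ge> 1"
  shows "c n = 0"
proof -
  have per: "c (n + p) = c n" if "n \<ge> 1" for n
    using per that by (auto simp: periodic_from_def)
  have odd: "c (Suc n) = - c n" if n: "odd n" for n
  proof -
    obtain k where "n = 2 * k + 1" using n by (rule oddE)
    then show ?thesis using anti[rule_format, of "Suc k"] by simp
  qed
  have alt: "c (Suc n) = - c n" if "n \<ge> 1" for n
  proof (cases "odd n")
    case False
    then show ?thesis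
      using odd[of "n + p"] per[of n] per[of "Suc n"] that \<open>odd p\<close> by simp
  qed (rule odd)
  have pow: "c (Suc k) = (- 1) ^ k * c 1" for k
    by (induction k) (simp_all add: alt)
  have "c 1 = 0"
    using pow[of p] per[of 1] \<open>odd p\<close> by simp
  then show ?thesis
    using pow[of "n - 1"] \<open>n \<ge> 1\<close> by simp
qed

theorem corollary4p1p1:
  fixes p :: nat and c d m :: "nat \<Rightarrow> real" and \<mu> :: "complex measure"
  assumes "p \<ge> 1"
    and "positive_chain_sequence d"
    and "minimal_parameter_sequence d m"
    and "associated_measure c d \<mu>"
    and "periodic_from 1 p c"
    and "periodic_from 1 p m"
    and "\<forall>n\<ge>1. c (2 * n) = - c (2 * n - 1)"
  shows "(even p \<longrightarrow> periodic_from 0 p (verblunsky \<mu>)) \<and>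
         (odd p \<longrightarrow> symmetric_circle_measure \<mu> \<and> periodic_from 0 p (verblunsky \<mu>))"
proof -
  have "\<exists>m'. minimal_parameter_sequence d m' \<and> (\<forall>n\<ge>1. verblunsky \<mu> (n - 1) =
      cnj (tau c (n - 1)) * ((1 - 2 * of_real (m' n) - \<i> * of_real (c n)) / (1 - \<i> * of_real (c n))))"
    using assms(4) by (simp add: associated_measure_def)
  then obtain m' where m': "minimal_parameter_sequence d m'"
    and "\<forall>n\<ge>1. verblunsky \<mu> (n - 1) =
      cnj (tau c (n - 1)) * ((1 - 2 * of_real (m' n) - \<i> * of_real (c n)) / (1 - \<i> * of_real (c n)))"
    by blast
  moreover have "m' = m"
    using minimal_parameter_sequence_unique[OF m' assms(3)] by blast
  ultimately have v: "verblunsky \<mu> n = cnj (tau c n) *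
      ((1 - 2 * of_real (m (Suc n)) - \<i> * of_real (c (Suc n))) / (1 - \<i> * of_real (c (Suc n))))" for n
    by (metis diff_Suc_1 le_add1 plus_1_eq_Suc)
  have per: "c (Suc (n + p)) = c (Suc n)" "m (Suc (n + p)) = m (Suc n)" for n
    using assms(5,6)[unfolded periodic_from_def, rule_format, of "Suc n"] by simp_all
  show ?thesis
  proof (intro conjI impI)
    assume "even p"
    then show "periodic_from 0 p (verblunsky \<mu>)"
      using tau_periodic[OF assms(7,5)] by (simp add: periodic_from_def v per)
  next
    assume "odd p"
    then have zero: "c n = 0" if "n \<ge> 1" for n
      using odd_period_imp_zero[OF assms(7,5)] that by blast
    have v0: "verblunsky \<mu> n = of_real (1 - 2 * m (Suc n))" for n
      by (simp add: v tau_def zero)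
    show "periodic_from 0 p (verblunsky \<mu>)"
      by (simp add: periodic_from_def v0 per)
    have "nontrivial_circle_measure \<mu>"
      using assms(4) by (simp add: associated_measure_def)
    then interpret nontrivial_circle \<mu>
      by (auto simp: nontrivial_circle_measure_def nontrivial_circle_def circle_prob_space_def
          circle_prob_space_axioms_def nontrivial_circle_axioms_def)
    show "symmetric_circle_measure \<mu>"
      by (intro symmetric_if_real_moments moments_real) (simp only: v0 Reals_of_real)
  qed
qed

end
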